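(* Let $n\ge 1$ and, for $j\in\{1,2,\dots,n\}$, let $A_j\in\mathcal{B}(H)$ be a selfadjoint operator with $\operatorname{sp}(A_j)\subset[\gamma,\Gamma]$, for some real numbers $\gamma<\Gamma$. Let $h:[\gamma,\Gamma]\to\mathbb{R}$ be non-negative and continuous and let $f,g:[\gamma,\Gamma]\to\mathbb{R}$ be continuous. If $f$ and $g$ are $h$-synchronous on $[\gamma,\Gamma]$, then $$\begin{aligned} &h^2\Big(\sum_{j=1}^n\langle A_jx_j,x_j\rangle\Big)\sum_{j=1}^n\langle f(A_j)g(A_j)x_j,x_j\rangle-\sum_{j=1}^n\langle h(A_j)f(A_j)x_j,x_j\rangle\sum_{j=1}^n\langle h(A_j)g(A_j)x_j,x_j\rangle\\ &\ \ge\ \Big[h\Big(\sum_{j=1}^n\langle A_jx_j,x_j\rangle\Big)\sum_{j=1}^n\langle h(A_j)f(A_j)x_j,x_j\rangle-\sum_{j=1}^n\langle h^2(A_j)x_j,x_j\rangle\, f\Big(\sum_{j=1}^n\langle A_jx_j,x_j\rangle\Big)\Big]\cdot g\Big(\sum_{j=1}^n\langle A_jx_j,x_j\rangle\Big)\\ &\quad+\Big[h\Big(\sum_{j=1}^n\langle A_jx_j,x_j\rangle\Big)f\Big(\sum_{j=1}^n\langle A_jx_j,x_j\rangle\Big)-\sum_{j=1}^n\langle h(A_j)f(A_j)x_j,x_j\rangle\Big]\cdot\sum_{j=1}^n\langle h(A_j)g(A_j)x_j,x_j\rangle \end{aligned}$$ for all $x_1,\dots,x_n\in H$ with $\sum_{j=1}^n\|x_j\|^2=1$.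 If $f$ and $g$ are $h$-asynchronous on $[\gamma,\Gamma]$, then the reverse inequality ($\le$) holds for all such $x_1,\dots,x_n$.
   Context: $(H,\langle\cdot,\cdot\rangle)$ is a complex Hilbert space, $\mathcal{B}(H)$ is the algebra of bounded linear operators on $H$, and $\operatorname{sp}(A)$ is the spectrum of $A$. For a selfadjoint $A$ and a continuous function $f$ on $\operatorname{sp}(A)$, $f(A)$ is defined by the continuous functional calculus; $h^2$ is the pointwise square of $h$. Given a non-negative function $h:[a,b]\to\mathbb{R}_+$, two functions $f,g:[a,b]\to\mathbb{R}$ are called $h$-synchronous (respectively $h$-asynchronous) on $[a,b]$ if $(h(y)f(x)-h(x)f(y))(h(y)g(x)-h(x)g(y))\ge 0$ (respectively $\le 0$) for all $x,y\in[a,b]$. *)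

theory Defs
  imports "HOL-Analysis.Analysis"
begin

text \<open>The inner product is linear in the first argument. Building on \<^class>\<open>banach\<close> supplies
  completeness and the norm topology; the axioms \<open>scaleR_scaleC\<close> and \<open>norm_eq_sqrt_cinner\<close> tie the
  underlying real normed structure to the complex one.\<close>

class complex_hilbert_space = banach +
  fixes scaleC :: "complex \<Rightarrow> 'a \<Rightarrow> 'a" (infixr "*\<^sub>C" 75)
    and cinner :: "'a \<Rightarrow> 'a \<Rightarrow> complex"
  assumes scaleC_add_right: "c *\<^sub>C (x + y) = c *\<^sub>C x + c *\<^sub>C y"
    and scaleC_add_left: "(c + d) *\<^sub>C x = c *\<^sub>C x + d *\<^sub>C x"
    and scaleC_scaleC: "c *\<^sub>C d *\<^sub>C x = (c * d) *\<^sub>C x"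
    and scaleC_one: "1 *\<^sub>C x = x"
    and scaleR_scaleC: "r *\<^sub>R x = complex_of_real r *\<^sub>C x"
    and cinner_commute: "cinner x y = cnj (cinner y x)"
    and cinner_add_left: "cinner (x + y) z = cinner x z + cinner y z"
    and cinner_scaleC_left: "cinner (c *\<^sub>C x) y = c * cinner x y"
    and cinner_ge_zero: "0 \<le> Re (cinner x x)"
    and cinner_eq_zero_iff: "cinner x x = 0 \<longleftrightarrow> x = 0"
    and norm_eq_sqrt_cinner: "norm x = sqrt (Re (cinner x x))"

text \<open>The type \<^typ>\<open>'a \<Rightarrow>\<^sub>L 'a\<close> consists of the bounded real-linear maps; the elements of \<open>B(H)\<close>
  are those that are moreover complex-linear. The operator norm is \<^const>\<open>norm\<close> on this type.\<close>

definition bounded_operator :: "('a::complex_hilbert_space \<Rightarrow>\<^sub>L 'a) \<Rightarrow> bool" where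
  "bounded_operator A \<longleftrightarrow> (\<forall>c x. A (c *\<^sub>C x) = c *\<^sub>C A x)"

definition is_adjoint :: "('a::complex_hilbert_space \<Rightarrow>\<^sub>L 'a) \<Rightarrow> ('a \<Rightarrow>\<^sub>L 'a) \<Rightarrow> bool" where
  "is_adjoint B A \<longleftrightarrow> (\<forall>x y. cinner (A x) y = cinner x (B y))"

definition selfadjoint :: "('a::complex_hilbert_space \<Rightarrow>\<^sub>L 'a) \<Rightarrow> bool" where
  "selfadjoint A \<longleftrightarrow> bounded_operator A \<and> is_adjoint A A"

text \<open>\<open>B\<close> is the inverse of \<open>A - z I\<close> in \<open>B(H)\<close>.\<close>

definition spectrum :: "('a::complex_hilbert_space \<Rightarrow>\<^sub>L 'a) \<Rightarrow> complex set" where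
  "spectrum A = {z. \<not> (\<exists>B. bounded_operator B \<and>
     (\<forall>x. B (A x - z *\<^sub>C x) = x) \<and> (\<forall>x. A (B x) - z *\<^sub>C B x = x))}"

text \<open>\<open>\<Phi>\<close> is the isometric unital \<open>*\<close>-homomorphism from \<open>C(sp(A))\<close> into \<open>B(H)\<close> that sends the
  identity function to \<open>A\<close>. Functions are total in HOL, so \<open>C(sp(A))\<close> is represented by the functions
  continuous on \<open>sp(A)\<close>; by the isometry condition \<open>\<Phi> f\<close> depends only on the restriction of \<open>f\<close> to
  \<open>sp(A)\<close>, and \<open>\<Phi>\<close> is unconstrained on all other functions.\<close>

definition is_functional_calculus ::
    "('a::complex_hilbert_space \<Rightarrow>\<^sub>L 'a) \<Rightarrow> ((complex \<Rightarrow> complex) \<Rightarrow> 'a \<Rightarrow>\<^sub>L 'a) \<Rightarrow> bool" where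
  "is_functional_calculus A \<Phi> \<longleftrightarrow>
     (\<forall>f. continuous_on (spectrum A) f \<longrightarrow>
        bounded_operator (\<Phi> f) \<and>
        (\<forall>c x. \<Phi> (\<lambda>z. c * f z) x = c *\<^sub>C \<Phi> f x) \<and>
        is_adjoint (\<Phi> (\<lambda>z. cnj (f z))) (\<Phi> f) \<and>
        norm (\<Phi> f) = (SUP z\<in>spectrum A. cmod (f z))) \<and>
     (\<forall>f g. continuous_on (spectrum A) f \<longrightarrow> continuous_on (spectrum A) g \<longrightarrow>
        \<Phi> (\<lambda>z. f z + g z) = \<Phi> f + \<Phi> g \<and>
        \<Phi> (\<lambda>z. f z * g z) = \<Phi> f o\<^sub>L \<Phi> g) \<and>
     \<Phi> (\<lambda>z. 1) = id_blinfun \<and>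
     \<Phi> (\<lambda>z. z) = A"

text \<open>For selfadjoint \<open>A\<close> on \<open>H \<noteq> {0}\<close> such a \<open>\<Phi>\<close> exists and is uniquely determined
  on \<open>C(sp(A))\<close>, so the choice is immaterial for functions continuous on the spectrum.\<close>

definition functional_calculus ::
    "('a::complex_hilbert_space \<Rightarrow>\<^sub>L 'a) \<Rightarrow> (complex \<Rightarrow> complex) \<Rightarrow> 'a \<Rightarrow>\<^sub>L 'a" where
  "functional_calculus A = (SOME \<Phi>. is_functional_calculus A \<Phi>)"

text \<open>The operator \<open>f(A)\<close> for a real function \<open>f\<close> and a selfadjoint \<open>A\<close>. The spectrum is a set of
  complex numbers with vanishing imaginary part, whence \<^const>\<open>Re\<close>.\<close>

definition apply_fun :: "(real \<Rightarrow> real) \<Rightarrow> ('a::complex_hilbert_space \<Rightarrow>\<^sub>L 'a) \<Rightarrow> 'a \<Rightarrow>\<^sub>L 'a" where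
  "apply_fun f A = functional_calculus A (\<lambda>z. complex_of_real (f (Re z)))"

definition h_synchronous_on ::
    "real set \<Rightarrow> (real \<Rightarrow> real) \<Rightarrow> (real \<Rightarrow> real) \<Rightarrow> (real \<Rightarrow> real) \<Rightarrow> bool" where
  "h_synchronous_on I h f g \<longleftrightarrow>
     (\<forall>x\<in>I. \<forall>y\<in>I. (h y * f x - h x * f y) * (h y * g x - h x * g y) \<ge> 0)"

definition h_asynchronous_on ::
    "real set \<Rightarrow> (real \<Rightarrow> real) \<Rightarrow> (real \<Rightarrow> real) \<Rightarrow> (real \<Rightarrow> real) \<Rightarrow> bool" where
  "h_asynchronous_on I h f g \<longleftrightarrow>
     (\<forall>x\<in>I. \<forall>y\<in>I. (h y * f x - h x * f y) * (h y * g x - h x * g y) \<le> 0)"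

text \<open>The sum of \<open>\<langle>T j (x j), x j\<rangle>\<close> over \<open>j = 1, ..., n\<close>. It is only used for selfadjoint \<open>T j\<close>, for
  which these inner products are real, so \<^const>\<open>Re\<close> merely converts the type.\<close>

definition quad_sum ::
    "nat \<Rightarrow> (nat \<Rightarrow> 'a::complex_hilbert_space \<Rightarrow>\<^sub>L 'a) \<Rightarrow> (nat \<Rightarrow> 'a) \<Rightarrow> real" where
  "quad_sum n T x = (\<Sum>j = 1..n. Re (cinner (T j (x j)) (x j)))"

end

theory Submission
  imports Defs "HOL-Computational_Algebra.Fundamental_Theorem_Algebra"
begin

text \<open>
  The inequality is the integrated form of a pointwise one. Put \<open>s = \<Sum>\<langle>A\<^sub>j x\<^sub>j, x\<^sub>j\<rangle>\<close>. For
  \<open>h\<close>-synchronous \<open>f\<close> and \<open>g\<close> the function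
  \<open>D t = (h s * f t - h t * f s) * (h s * g t - h t * g s)\<close> is nonnegative on \<open>[\<gamma>, \<Gamma>]\<close>. The map
  \<open>L F = \<Sum>\<langle>F(A\<^sub>j) x\<^sub>j, x\<^sub>j\<rangle>\<close> is a positive linear functional on the continuous functions, and
  \<open>L 1 = 1\<close>, \<open>L id = s\<close>. Positivity puts \<open>s\<close> into \<open>[\<gamma>, \<Gamma>]\<close> and gives \<open>L D \<ge> 0\<close>; expanding
  \<open>D\<close>, and using that the calculus is multiplicative, \<open>L D\<close> is the difference of the two sides
  (\<open>linear_functional_gap\<close>). In the asynchronous case \<open>D \<le> 0\<close>.

  Positivity of \<open>L\<close> comes from \<open>\<langle>F(A) x, x\<rangle> = \<parallel>\<surd>F(A) x\<parallel>\<^sup>2\<close>, a consequence of the axioms of the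
  functional calculus (\<open>quadratic_form_nonneg\<close>). Since \<^const>\<open>functional_calculus\<close> is a choice,
  those axioms hold for it only once some calculus has been constructed, and this is the bulk of
  the work. A polynomial in \<open>A\<close> has an obvious meaning, and the calculus is its extension by
  uniform limits, as the Weierstrass theorem provides, on the compact spectrum. The extension is
  well defined and isometric because \<open>\<parallel>p(A)\<parallel>\<close> is the maximum of \<open>\<bar>p\<bar>\<close> over the spectrum. One
  inequality combines spectral mapping (\<open>poly_in_spectrum\<close>) with the bound of the spectrum by the
  norm (\<open>invertible_of_norm_less\<close>). The other (\<open>norm_poly_op_attained\<close>) is reduced by
  \<open>\<parallel>B\<parallel>\<^sup>2 \<le> \<parallel>B\<^sup>* B\<parallel>\<close> to the fact that a selfadjoint operator \<open>B\<close> has \<open>\<parallel>B\<parallel>\<close> or \<open>-\<parallel>B\<parallel>\<close> in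
  its spectrum (\<open>selfadjoint_norm_in_spectrum\<close>). Factoring polynomials into linear factors makes
  both halves of spectral mapping elementary.
\<close>

section \<open>Complex Hilbert spaces and their bounded operators\<close>

lemma cinner_add_right: "cinner x (y + z) = cinner x y + cinner x z"
  for x y z :: "'a::complex_hilbert_space"
  by (metis cinner_add_left cinner_commute complex_cnj_add)

lemma cinner_scaleC_right: "cinner x (c *\<^sub>C y) = cnj c * cinner x y"
  for x y :: "'a::complex_hilbert_space"
  by (metis cinner_commute cinner_scaleC_left complex_cnj_mult)

lemma scaleC_minus_one: "(- 1) *\<^sub>C x = - x" for x :: "'a::complex_hilbert_space"
  using scaleR_scaleC[of "-1" x] by simp

lemma scaleC_minus_left: "(- c) *\<^sub>C x = - (c *\<^sub>C x)" for x :: "'a::complex_hilbert_space"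
  by (metis mult_minus1 scaleC_minus_one scaleC_scaleC)

lemma scaleC_zero_left: "0 *\<^sub>C x = 0" for x :: "'a::complex_hilbert_space"
  using scaleR_scaleC[of 0 x] by simp

lemma cinner_zero_left: "cinner 0 y = 0" for y :: "'a::complex_hilbert_space"
  using cinner_add_left[of 0 0 y] by simp

lemma cinner_zero_right: "cinner y 0 = 0" for y :: "'a::complex_hilbert_space"
  using cinner_add_right[of y 0 0] by simp

lemma cinner_minus_left: "cinner (- x) y = - cinner x y"
  for x y :: "'a::complex_hilbert_space"
  by (metis cinner_scaleC_left scaleC_minus_one mult_minus1)

lemma cinner_minus_right: "cinner x (- y) = - cinner x y"
  for x y :: "'a::complex_hilbert_space"
  by (metis cinner_commute cinner_minus_left complex_cnj_minus)

lemma cinner_diff_left: "cinner (x - y) z = cinner x z - cinner y z"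
  for x y z :: "'a::complex_hilbert_space"
  using cinner_add_left[of x "- y" z] by (simp add: cinner_minus_left)

lemma cinner_diff_right: "cinner x (y - z) = cinner x y - cinner x z"
  for x y z :: "'a::complex_hilbert_space"
  using cinner_add_right[of x y "- z"] by (simp add: cinner_minus_right)

lemma Re_cinner_self: "Re (cinner x x) = (norm x)\<^sup>2" for x :: "'a::complex_hilbert_space"
  by (simp add: norm_eq_sqrt_cinner cinner_ge_zero)

lemma norm_scaleC: "norm (c *\<^sub>C x) = cmod c * norm x" for x :: "'a::complex_hilbert_space"
proof -
  have "cinner (c *\<^sub>C x) (c *\<^sub>C x) = of_real ((cmod c)\<^sup>2) * cinner x x"
    unfolding complex_norm_square by (simp add: cinner_scaleC_left cinner_scaleC_right)
  hence "(norm (c *\<^sub>C x))\<^sup>2 = (cmod c * norm x)\<^sup>2"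
    by (metis Re_cinner_self Re_complex_of_real times_complex.sel(1) Im_complex_of_real
        mult_zero_left diff_zero power_mult_distrib)
  thus ?thesis by (simp add: power2_eq_iff_nonneg)
qed

lemma Re_cinner_commute: "Re (cinner y x) = Re (cinner x y)"
  for x y :: "'a::complex_hilbert_space"
  by (metis cinner_commute cnj.sel(1))

lemma norm_diff_square: "(norm (x - y))\<^sup>2 = (norm x)\<^sup>2 - 2 * Re (cinner x y) + (norm y)\<^sup>2"
  for x y :: "'a::complex_hilbert_space"
  using Re_cinner_commute[of x y]
  by (simp add: Re_cinner_self[symmetric] cinner_diff_left cinner_diff_right)

text \<open>The norm is already known to satisfy the triangle inequality, and expanding
  \<open>(norm (x + y))\<^sup>2 \<le> (norm x + norm y)\<^sup>2\<close> leaves exactly this half of Cauchy-Schwarz.\<close>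

lemma Re_cinner_le: "Re (cinner x y) \<le> norm x * norm y"
  for x y :: "'a::complex_hilbert_space"
proof -
  have "(norm (x + y))\<^sup>2 = (norm x)\<^sup>2 + 2 * Re (cinner x y) + (norm y)\<^sup>2"
    using Re_cinner_commute[of x y]
    by (simp add: Re_cinner_self[symmetric] cinner_add_left cinner_add_right)
  moreover have "(norm (x + y))\<^sup>2 \<le> (norm x + norm y)\<^sup>2"
    by (intro power_mono norm_triangle_ineq) simp
  ultimately show ?thesis by (simp add: power2_sum)
qed

lemma cmod_cinner_le: "cmod (cinner x y) \<le> norm x * norm y"
  for x y :: "'a::complex_hilbert_space"
proof (cases "cinner x y = 0")
  case False
  define c where "c = cnj (sgn (cinner x y))"
  have "cmod c = 1" using False by (simp add: c_def norm_sgn)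
  have "c * cinner x y = of_real (cmod (cinner x y))"
    using False unfolding c_def sgn_eq
    by (simp add: complex_norm_square[symmetric] power2_eq_square divide_simps mult.commute[of "cnj _"])
  hence "cmod (cinner x y) = Re (cinner (c *\<^sub>C x) y)"
    by (simp add: cinner_scaleC_left)
  also have "\<dots> \<le> norm (c *\<^sub>C x) * norm y" by (rule Re_cinner_le)
  finally show ?thesis using \<open>cmod c = 1\<close> by (simp add: norm_scaleC)
qed simp

lemma bounded_bilinear_cinner:
  "bounded_bilinear (cinner :: 'a::complex_hilbert_space \<Rightarrow> 'a \<Rightarrow> complex)"
proof
  show "\<exists>K. \<forall>(a::'a) b. norm (cinner a b) \<le> norm a * norm b * K"
    by (rule exI[of _ 1]) (simp add: cmod_cinner_le)
qed (simp_all add: cinner_add_left cinner_add_right scaleR_scaleC cinner_scaleC_left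
    cinner_scaleC_right scaleR_conv_of_real)

text \<open>Complex scalars act on operators by composition with this one, since the bounded real-linear
  maps as a type form only a real vector space.\<close>

definition scalar_op :: "complex \<Rightarrow> 'a::complex_hilbert_space \<Rightarrow>\<^sub>L 'a" where
  "scalar_op c = Blinfun (\<lambda>x. c *\<^sub>C x)"

lemma scaleC_scaleR_commute: "c *\<^sub>C (r *\<^sub>R x) = r *\<^sub>R (c *\<^sub>C x)"
  for x :: "'a::complex_hilbert_space"
  by (simp add: scaleR_scaleC scaleC_scaleC mult.commute)

lemma bounded_linear_scaleC: "bounded_linear (\<lambda>x::'a::complex_hilbert_space. c *\<^sub>C x)"
  by (rule bounded_linear_intro[of _ "cmod c"])
    (simp_all add: scaleC_add_right scaleC_scaleR_commute norm_scaleC mult.commute)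

lemma scalar_op_apply [simp]: "scalar_op c x = c *\<^sub>C x"
  by (simp add: scalar_op_def bounded_linear_Blinfun_apply bounded_linear_scaleC)

lemma scalar_op_0 [simp]: "scalar_op 0 = 0"
  by (rule blinfun_eqI) (simp add: scaleC_zero_left)

lemma scalar_op_1 [simp]: "scalar_op 1 = id_blinfun"
  by (rule blinfun_eqI) (simp add: scaleC_one)

lemma scalar_op_add: "scalar_op (c + d) = scalar_op c + scalar_op d"
  by (rule blinfun_eqI) (simp add: scaleC_add_left blinfun.add_left)

lemma scalar_op_mult: "scalar_op (c * d) = (scalar_op c o\<^sub>L scalar_op d)"
  by (rule blinfun_eqI) (simp add: scaleC_scaleC)

lemma scalar_op_minus: "scalar_op (- c) = - scalar_op c"
  using scalar_op_add[of c "- c"] by (simp add: eq_neg_iff_add_eq_0 add.commute)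

lemma bounded_operator_scalar_op [simp]: "bounded_operator (scalar_op c)"
  by (simp add: bounded_operator_def scaleC_scaleC mult.commute)

lemma bounded_operatorD: "bounded_operator A \<Longrightarrow> A (c *\<^sub>C x) = c *\<^sub>C A x"
  by (simp add: bounded_operator_def)

lemma bounded_operator_0 [simp]: "bounded_operator 0"
  using bounded_operator_scalar_op[of 0] by simp

lemma scaleC_diff_right: "c *\<^sub>C (x - y) = c *\<^sub>C x - c *\<^sub>C y"
  for x y :: "'a::complex_hilbert_space"
  using scaleC_add_right[of c "x - y" y] by simp

lemma bounded_operator_add:
  "bounded_operator A \<Longrightarrow> bounded_operator B \<Longrightarrow> bounded_operator (A + B)"
  by (simp add: bounded_operator_def blinfun.add_left scaleC_add_right)

lemma bounded_operator_diff:
  "bounded_operator A \<Longrightarrow> bounded_operator B \<Longrightarrow> bounded_operator (A - B)"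
  by (simp add: bounded_operator_def blinfun.diff_left scaleC_diff_right)

lemma bounded_operator_compose:
  "bounded_operator A \<Longrightarrow> bounded_operator B \<Longrightarrow> bounded_operator (A o\<^sub>L B)"
  by (simp add: bounded_operator_def)

lemma bounded_operator_limit:
  assumes "\<And>n. bounded_operator (X n)" "X \<longlonglongrightarrow> B"
  shows "bounded_operator B"
  unfolding bounded_operator_def
proof (intro allI)
  fix c x
  have "(\<lambda>n. X n (c *\<^sub>C x)) \<longlonglongrightarrow> B (c *\<^sub>C x)"
    using assms(2) by (intro tendsto_intros)
  moreover have "(\<lambda>n. c *\<^sub>C X n x) \<longlonglongrightarrow> c *\<^sub>C B x"
    using assms(2) by (intro bounded_linear.tendsto[OF bounded_linear_scaleC] tendsto_intros)
  ultimately show "B (c *\<^sub>C x) = c *\<^sub>C B x"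
    using LIMSEQ_unique assms(1) by (auto simp: bounded_operatorD)
qed

lemma is_adjoint_limit:
  assumes "\<And>n. is_adjoint (Y n) (X n)" "X \<longlonglongrightarrow> B" "Y \<longlonglongrightarrow> C"
  shows "is_adjoint C B"
  unfolding is_adjoint_def
proof (intro allI)
  fix x y
  have "(\<lambda>n. cinner (X n x) y) \<longlonglongrightarrow> cinner (B x) y"
    using assms(2) by (intro bounded_bilinear.tendsto[OF bounded_bilinear_cinner] tendsto_intros)
  moreover have "(\<lambda>n. cinner x (Y n y)) \<longlonglongrightarrow> cinner x (C y)"
    using assms(3) by (intro bounded_bilinear.tendsto[OF bounded_bilinear_cinner] tendsto_intros)
  ultimately show "cinner (B x) y = cinner x (C y)"
    using LIMSEQ_unique assms(1) by (auto simp: is_adjoint_def)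
qed

text \<open>The identity \<open>\<parallel>B\<^sup>* B\<parallel> = \<parallel>B\<parallel>\<^sup>2\<close>, of which one inequality is enough: it transfers norm estimates
  from selfadjoint operators to all operators that have an adjoint.\<close>

lemma norm_le_adjoint_compose:
  assumes "is_adjoint C B"
  shows "(norm B)\<^sup>2 \<le> norm (C o\<^sub>L B)"
proof -
  have "norm (B x) \<le> sqrt (norm (C o\<^sub>L B)) * norm x" for x
  proof (rule power2_le_imp_le)
    have "(norm (B x))\<^sup>2 = Re (cinner x (C (B x)))"
      using assms by (simp add: Re_cinner_self[symmetric] is_adjoint_def)
    also have "\<dots> \<le> norm x * norm ((C o\<^sub>L B) x)"
      using Re_cinner_le by simp
    also have "\<dots> \<le> norm x * (norm (C o\<^sub>L B) * norm x)"
      by (intro mult_left_mono norm_blinfun) simp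
    finally show "(norm (B x))\<^sup>2 \<le> (sqrt (norm (C o\<^sub>L B)) * norm x)\<^sup>2"
      by (simp add: power_mult_distrib power2_eq_square mult_ac)
  qed simp
  hence "norm B \<le> sqrt (norm (C o\<^sub>L B))"
    by (intro norm_blinfun_bound) auto
  thus ?thesis
    by (metis norm_ge_zero power_mono real_sqrt_pow2)
qed

section \<open>Invertibility and the spectrum\<close>

definition boundedly_invertible :: "('a::complex_hilbert_space \<Rightarrow>\<^sub>L 'a) \<Rightarrow> bool" where
  "boundedly_invertible A \<longleftrightarrow>
     (\<exists>B. bounded_operator B \<and> (B o\<^sub>L A) = id_blinfun \<and> (A o\<^sub>L B) = id_blinfun)"

lemma blinfun_eq_iff: "A = B \<longleftrightarrow> (\<forall>x. blinfun_apply A x = blinfun_apply B x)"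
  by (auto intro: blinfun_eqI)

lemma spectrum_iff: "z \<in> spectrum A \<longleftrightarrow> \<not> boundedly_invertible (A - scalar_op z)"
  by (simp add: spectrum_def boundedly_invertible_def blinfun_eq_iff blinfun.diff_left)

lemma compose_assoc: "((A o\<^sub>L B) o\<^sub>L C) = (A o\<^sub>L (B o\<^sub>L C))"
  by (rule blinfun_eqI) simp

lemma compose_id [simp]: "(A o\<^sub>L id_blinfun) = A" "(id_blinfun o\<^sub>L A) = A"
  by (rule blinfun_eqI, simp)+

lemma boundedly_invertible_compose:
  assumes "boundedly_invertible A" "boundedly_invertible B"
  shows "boundedly_invertible (A o\<^sub>L B)"
proof -
  obtain A' B' where "bounded_operator A'" "(A' o\<^sub>L A) = id_blinfun" "(A o\<^sub>L A') = id_blinfun"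
    "bounded_operator B'" "(B' o\<^sub>L B) = id_blinfun" "(B o\<^sub>L B') = id_blinfun"
    using assms by (auto simp: boundedly_invertible_def)
  hence "bounded_operator (B' o\<^sub>L A')" "((B' o\<^sub>L A') o\<^sub>L (A o\<^sub>L B)) = id_blinfun"
    "((A o\<^sub>L B) o\<^sub>L (B' o\<^sub>L A')) = id_blinfun"
    by (auto simp: bounded_operator_compose compose_assoc) (metis compose_assoc compose_id)+
  thus ?thesis unfolding boundedly_invertible_def by blast
qed

lemma boundedly_invertible_scalar_op:
  assumes "c \<noteq> 0"
  shows "boundedly_invertible (scalar_op c :: 'a::complex_hilbert_space \<Rightarrow>\<^sub>L 'a)"
  unfolding boundedly_invertible_def
  by (rule exI[of _ "scalar_op (1 / c)"]) (use assms in \<open>simp add: scalar_op_mult[symmetric]\<close>)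

text \<open>If a product of commuting operators is invertible then so is each factor: the inverse of the
  product yields a left and a right inverse of the factor, and these two coincide.\<close>

lemma boundedly_invertible_factor:
  assumes "boundedly_invertible (A o\<^sub>L R)" "(A o\<^sub>L R) = (R o\<^sub>L A)" "bounded_operator R"
  shows "boundedly_invertible A"
proof -
  obtain C where C: "bounded_operator C" "(C o\<^sub>L (A o\<^sub>L R)) = id_blinfun"
    "((A o\<^sub>L R) o\<^sub>L C) = id_blinfun"
    using assms(1) by (auto simp: boundedly_invertible_def)
  have left: "((C o\<^sub>L R) o\<^sub>L A) = id_blinfun"
    using C(2) assms(2) by (simp add: compose_assoc)
  have right: "(A o\<^sub>L (R o\<^sub>L C)) = id_blinfun"
    using C(3) by (simp add: compose_assoc)
  have "(C o\<^sub>L R) = (R o\<^sub>L C)"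
    by (metis compose_assoc compose_id left right)
  with left right C(1) assms(3) show ?thesis
    unfolding boundedly_invertible_def by (metis bounded_operator_compose)
qed

text \<open>The Neumann series in fixed point form: \<open>B x - c x = y\<close> says that \<open>x\<close> is a fixed point of
  \<open>x \<mapsto> (B x - y) / c\<close>, which contracts by the factor \<open>\<parallel>B\<parallel> / \<bar>c\<bar> < 1\<close>.\<close>

lemma invertible_of_norm_less:
  fixes B :: "'a::complex_hilbert_space \<Rightarrow>\<^sub>L 'a"
  assumes B: "bounded_operator B" and less: "norm B < cmod c"
  shows "boundedly_invertible (B - scalar_op c)"
proof -
  define T where "T = B - scalar_op c"
  have c: "c \<noteq> 0" using less by (metis norm_zero norm_ge_zero not_le)
  have lower: "(cmod c - norm B) * norm x \<le> norm (T x)" for x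
  proof -
    have "cmod c * norm x - norm B * norm x \<le> norm (c *\<^sub>C x) - norm (B x)"
      using norm_blinfun[of B x] by (simp add: norm_scaleC)
    also have "\<dots> \<le> norm (T x)"
      unfolding T_def blinfun.diff_left scalar_op_apply
      by (metis norm_minus_commute norm_triangle_ineq2)
    finally show ?thesis by (simp add: algebra_simps)
  qed
  have sol: "\<exists>!x. T x = y" for y
  proof -
    define F where "F x = (1 / c) *\<^sub>C (B x - y)" for x
    have "dist (F x) (F x') \<le> norm B / cmod c * dist x x'" for x x'
    proof -
      have "F x - F x' = (1 / c) *\<^sub>C B (x - x')"
        by (simp add: F_def scaleC_diff_right[symmetric] blinfun.diff_right)
      hence "dist (F x) (F x') = norm (B (x - x')) / cmod c"
        by (simp add: dist_norm norm_scaleC norm_divide)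
      also have "\<dots> \<le> norm B * norm (x - x') / cmod c"
        by (intro divide_right_mono norm_blinfun) simp
      finally show ?thesis by (simp add: dist_norm)
    qed
    hence "\<exists>!x. F x = x"
      using less c by (intro banach_fix_type[of "norm B / cmod c"]) auto
    moreover have "F x = x \<longleftrightarrow> T x = y" for x
    proof -
      have "F x = x \<longleftrightarrow> c *\<^sub>C F x = c *\<^sub>C x"
        using c by (metis scaleC_one scaleC_scaleC nonzero_eq_divide_eq)
      also have "c *\<^sub>C F x = B x - y" using c by (simp add: F_def scaleC_scaleC scaleC_one)
      finally show ?thesis by (auto simp: T_def blinfun.diff_left algebra_simps)
    qed
    ultimately show ?thesis by simp
  qed
  define S where "S y = (THE x. T x = y)" for y
  have TS: "T (S y) = y" for y unfolding S_def by (rule theI'[OF sol])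
  have ST: "S (T x) = x" for x using sol TS by blast
  have T: "bounded_operator T" unfolding T_def by (intro bounded_operator_diff B) simp
  have S_add: "S (x + y) = S x + S y" for x y
    by (metis ST TS blinfun.add_right)
  have S_scale: "S (d *\<^sub>C x) = d *\<^sub>C S x" for d x
    by (metis ST TS T bounded_operatorD)
  have "bounded_linear S"
  proof (rule bounded_linear_intro[of _ "1 / (cmod c - norm B)"])
    show "norm (S x) \<le> norm x * (1 / (cmod c - norm B))" for x
      using lower[of "S x"] less by (simp add: TS field_simps)
  qed (auto simp: S_add S_scale scaleR_scaleC)
  hence "blinfun_apply (Blinfun S) = S" by (rule bounded_linear_Blinfun_apply)
  hence "bounded_operator (Blinfun S)" "(Blinfun S o\<^sub>L T) = id_blinfun"
    "(T o\<^sub>L Blinfun S) = id_blinfun"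
    by (auto simp: bounded_operator_def S_scale ST TS intro!: blinfun_eqI)
  thus ?thesis unfolding boundedly_invertible_def T_def by blast
qed

lemma spectrum_norm_le:
  assumes "bounded_operator B" "z \<in> spectrum B"
  shows "cmod z \<le> norm B"
  using assms invertible_of_norm_less[of B z] by (force simp: spectrum_iff)

text \<open>Invertibility is stable: with \<open>B\<close> the inverse of \<open>A - z\<close> one has
  \<open>A - w = (A - z)(1 - (w - z) B)\<close>, and the second factor is invertible for small \<open>w - z\<close>.\<close>

lemma closed_spectrum:
  assumes A: "bounded_operator A"
  shows "closed (spectrum A)"
proof -
  have "\<exists>e>0. ball z e \<subseteq> - spectrum A" if z: "z \<notin> spectrum A" for z
  proof -
    obtain B where B: "bounded_operator B" "(B o\<^sub>L (A - scalar_op z)) = id_blinfun"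
      "((A - scalar_op z) o\<^sub>L B) = id_blinfun"
      using z by (auto simp: spectrum_iff boundedly_invertible_def)
    have "w \<notin> spectrum A" if w: "dist z w < 1 / (norm B + 1)" for w
    proof (cases "w = z")
      case False
      define d where "d = w - z"
      have d: "d \<noteq> 0" using False by (simp add: d_def)
      have "cmod d * (norm B + 1) < 1"
        using w norm_ge_zero[of B]
        by (simp add: d_def dist_norm norm_minus_commute pos_less_divide_eq del: norm_ge_zero)
      hence "norm B < cmod (1 / d)"
        using d by (simp add: norm_divide field_simps) (use norm_ge_zero[of d] in linarith)
      hence "boundedly_invertible (B - scalar_op (1 / d))"
        by (rule invertible_of_norm_less[OF B(1)])
      hence "boundedly_invertible
          ((A - scalar_op z) o\<^sub>L (scalar_op (- d) o\<^sub>L (B - scalar_op (1 / d))))"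
        using z d
        by (intro boundedly_invertible_compose boundedly_invertible_scalar_op)
          (auto simp: spectrum_iff)
      also have "((A - scalar_op z) o\<^sub>L (scalar_op (- d) o\<^sub>L (B - scalar_op (1 / d)))) =
          A - scalar_op w"
      proof (rule blinfun_eqI)
        fix x
        have AB: "A (B x) - z *\<^sub>C B x = x"
          using arg_cong[OF B(3), of "\<lambda>T. blinfun_apply T x"] by (simp add: blinfun.diff_left)
        have "((A - scalar_op z) o\<^sub>L (scalar_op (- d) o\<^sub>L (B - scalar_op (1 / d)))) x
            = (- d) *\<^sub>C ((A (B x) - z *\<^sub>C B x) - (1 / d) *\<^sub>C (A x - z *\<^sub>C x))"
          by (simp add: blinfun.diff_left blinfun.diff_right bounded_operatorD[OF A]
              scaleC_diff_right scaleC_scaleC mult_ac)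
        also have "\<dots> = (- d) *\<^sub>C x + (A x - z *\<^sub>C x)"
          using d by (simp add: AB scaleC_diff_right scaleC_scaleC scaleC_minus_one)
            (simp add: scaleC_minus_left)
        also have "\<dots> = (A - scalar_op w) x"
          using scaleC_add_left[of d z x]
          by (simp only: scaleC_minus_left) (simp add: d_def blinfun.diff_left)
        finally show "((A - scalar_op z) o\<^sub>L (scalar_op (- d) o\<^sub>L (B - scalar_op (1 / d)))) x
            = (A - scalar_op w) x" .
      qed
      finally show ?thesis by (simp add: spectrum_iff)
    qed (use z in simp)
    thus ?thesis
      by (intro exI[of _ "1 / (norm B + 1)"]) (auto simp: add_nonneg_pos)
  qed
  thus ?thesis
    by (simp add: closed_def open_contains_ball)
qed

lemma compact_spectrum:
  assumes "bounded_operator A"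
  shows "compact (spectrum A)"
  using closed_spectrum[OF assms] spectrum_norm_le[OF assms]
  by (auto simp: compact_eq_bounded_closed bounded_iff)

text \<open>A selfadjoint operator attains its norm on its spectrum. Write \<open>N = \<parallel>B\<parallel>\<close>. Unit vectors \<open>x\<close> with
  \<open>\<parallel>B x\<parallel>\<close> close to \<open>N\<close> are almost eigenvectors of \<open>B\<^sup>2\<close> for \<open>N\<^sup>2\<close>, because
  \<open>\<parallel>B\<^sup>2 x - N\<^sup>2 x\<parallel>\<^sup>2 \<le> N\<^sup>2 (N\<^sup>2 \<parallel>x\<parallel>\<^sup>2 - \<parallel>B x\<parallel>\<^sup>2)\<close>. So \<open>B\<^sup>2 - N\<^sup>2 = (B - N)(B + N)\<close> is not bounded
  below, and one of its factors is not invertible.\<close>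

lemma selfadjoint_norm_in_spectrum:
  fixes B :: "'a::complex_hilbert_space \<Rightarrow>\<^sub>L 'a"
  assumes B: "selfadjoint B" and nontrivial: "\<exists>x::'a. x \<noteq> 0"
  shows "\<exists>r. of_real r \<in> spectrum B \<and> \<bar>r\<bar> = norm B"
proof (rule ccontr)
  define N where "N = norm B"
  assume "\<not> ?thesis"
  hence no: "of_real N \<notin> spectrum B" "of_real (- N) \<notin> spectrum B"
    unfolding N_def by (metis abs_norm_cancel abs_minus_cancel)+
  define T where "T = ((B - scalar_op (of_real N)) o\<^sub>L (B - scalar_op (of_real (- N))))"
  have "boundedly_invertible T"
    unfolding T_def by (intro boundedly_invertible_compose) (use no in \<open>auto simp: spectrum_iff\<close>)
  then obtain C where C: "(C o\<^sub>L T) = id_blinfun" by (auto simp: boundedly_invertible_def)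
  have T_apply: "T x = B (B x) - N\<^sup>2 *\<^sub>R x" for x
    by (simp add: T_def blinfun.diff_left blinfun.diff_right blinfun.add_left blinfun.add_right
        scalar_op_minus blinfun.minus_left scaleR_scaleC[symmetric] blinfun.scaleR_right
        power2_eq_square scaleR_diff_right scaleR_add_right)
  have adj: "cinner (B x) y = cinner x (B y)" for x y
    using B by (simp add: selfadjoint_def is_adjoint_def)
  have T_norm: "(norm (T x))\<^sup>2 \<le> N\<^sup>2 * (N\<^sup>2 * (norm x)\<^sup>2 - (norm (B x))\<^sup>2)" for x
  proof -
    have "Re (cinner (B (B x)) x) = (norm (B x))\<^sup>2"
      by (simp add: adj[of "B x"] Re_cinner_self)
    hence "Re (cinner (B (B x)) (N\<^sup>2 *\<^sub>R x)) = N\<^sup>2 * (norm (B x))\<^sup>2"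
      by (simp add: bounded_bilinear.scaleR_right[OF bounded_bilinear_cinner])
    hence "(norm (T x))\<^sup>2 = (norm (B (B x)))\<^sup>2 - 2 * N\<^sup>2 * (norm (B x))\<^sup>2 + (N\<^sup>2)\<^sup>2 * (norm x)\<^sup>2"
      unfolding T_apply norm_diff_square by (simp add: power_mult_distrib)
    moreover have "(norm (B (B x)))\<^sup>2 \<le> (N * norm (B x))\<^sup>2"
      unfolding N_def by (intro power_mono norm_blinfun) simp
    ultimately show ?thesis by (simp add: power_mult_distrib algebra_simps power2_eq_square)
  qed
  define K where "K = (norm C)\<^sup>2 * N\<^sup>2"
  have bound: "(norm x)\<^sup>2 \<le> K * (N\<^sup>2 * (norm x)\<^sup>2 - (norm (B x))\<^sup>2)" for x
  proof -
    have "C (T x) = x" using arg_cong[OF C, of "\<lambda>S. blinfun_apply S x"] by simp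
    hence "(norm x)\<^sup>2 \<le> (norm C * norm (T x))\<^sup>2"
      by (intro power_mono) (metis norm_blinfun, simp)
    also have "\<dots> \<le> (norm C)\<^sup>2 * (N\<^sup>2 * (N\<^sup>2 * (norm x)\<^sup>2 - (norm (B x))\<^sup>2))"
      unfolding power_mult_distrib by (intro mult_left_mono T_norm) simp
    finally show ?thesis by (simp add: K_def mult_ac)
  qed
  obtain x0 :: 'a where "x0 \<noteq> 0" using nontrivial by blast
  have "K \<noteq> 0"
  proof
    assume "K = 0"
    hence "(norm x0)\<^sup>2 \<le> 0" using bound[of x0] by simp
    thus False using \<open>x0 \<noteq> 0\<close> by simp
  qed
  moreover have "K \<ge> 0" unfolding K_def by simp
  ultimately have K: "K > 0" by simp
  have Bx: "(norm (B x))\<^sup>2 \<le> (N\<^sup>2 - 1 / K) * (norm x)\<^sup>2" for x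
  proof -
    have "(norm x)\<^sup>2 / K \<le> N\<^sup>2 * (norm x)\<^sup>2 - (norm (B x))\<^sup>2"
      using bound[of x] K by (simp add: pos_divide_le_eq mult.commute)
    thus ?thesis by (simp add: left_diff_distrib)
  qed
  have nonneg: "N\<^sup>2 - 1 / K \<ge> 0"
  proof -
    have "0 \<le> (N\<^sup>2 - 1 / K) * (norm x0)\<^sup>2"
      using Bx[of x0] by (rule order_trans[rotated]) simp
    thus ?thesis using \<open>x0 \<noteq> 0\<close> by (simp only: zero_le_mult_iff) auto
  qed
  have "norm (B x) \<le> sqrt (N\<^sup>2 - 1 / K) * norm x" for x
  proof (rule power2_le_imp_le)
    show "(norm (B x))\<^sup>2 \<le> (sqrt (N\<^sup>2 - 1 / K) * norm x)\<^sup>2"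
      unfolding power_mult_distrib real_sqrt_pow2[OF nonneg] by (rule Bx)
    show "0 \<le> sqrt (N\<^sup>2 - 1 / K) * norm x"
      by (intro mult_nonneg_nonneg real_sqrt_ge_zero nonneg norm_ge_zero)
  qed
  hence "norm B \<le> sqrt (N\<^sup>2 - 1 / K)"
    by (rule norm_blinfun_bound[OF real_sqrt_ge_zero[OF nonneg]])
  hence "N\<^sup>2 \<le> (sqrt (N\<^sup>2 - 1 / K))\<^sup>2"
    unfolding N_def by (rule power_mono) (rule norm_ge_zero)
  hence "1 / K \<le> 0"
    unfolding real_sqrt_pow2[OF nonneg] by linarith
  moreover have "1 / K > 0" using K by (rule divide_pos_pos[OF zero_less_one])
  ultimately show False by linarith
qed

section \<open>Polynomials of an operator\<close>

text \<open>The operator \<open>p(A)\<close>, by Horner's scheme.\<close>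

definition poly_op :: "('a::complex_hilbert_space \<Rightarrow>\<^sub>L 'a) \<Rightarrow> complex poly \<Rightarrow> 'a \<Rightarrow>\<^sub>L 'a" where
  "poly_op A p = fold_coeffs (\<lambda>c B. scalar_op c + (A o\<^sub>L B)) p 0"

lemma poly_op_0 [simp]: "poly_op A 0 = 0"
  by (simp add: poly_op_def)

lemma compose_0 [simp]: "(A o\<^sub>L 0) = 0" "(0 o\<^sub>L A) = 0"
  by (rule blinfun_eqI, simp)+

lemma poly_op_pCons [simp]: "poly_op A (pCons c p) = scalar_op c + (A o\<^sub>L poly_op A p)"
  by (cases "c = 0 \<and> p = 0") (auto simp: poly_op_def)

lemma poly_op_add: "poly_op A (p + q) = poly_op A p + poly_op A q"
  by (induction p q rule: poly_induct2)
    (auto simp: scalar_op_add blinfun_eq_iff blinfun.add_left blinfun.add_right)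

lemma bounded_operator_poly_op: "bounded_operator A \<Longrightarrow> bounded_operator (poly_op A p)"
  by (induction p) (auto intro!: bounded_operator_add bounded_operator_compose)

lemma poly_op_smult:
  assumes "bounded_operator A"
  shows "poly_op A (smult c p) = (scalar_op c o\<^sub>L poly_op A p)"
  by (induction p)
    (use assms in \<open>auto simp: scalar_op_mult blinfun_eq_iff blinfun.add_left scaleC_add_right
      bounded_operatorD\<close>)

lemma poly_op_minus: "bounded_operator A \<Longrightarrow> poly_op A (- p) = - poly_op A p"
  using poly_op_smult[of A "-1" p]
  by (simp add: blinfun_eq_iff blinfun.minus_left scaleC_minus_one scalar_op_minus)

lemma poly_op_diff: "bounded_operator A \<Longrightarrow> poly_op A (p - q) = poly_op A p - poly_op A q"
  using poly_op_add[of A p "- q"] by (simp add: poly_op_minus)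

lemma poly_op_mult:
  assumes "bounded_operator A"
  shows "poly_op A (p * q) = (poly_op A p o\<^sub>L poly_op A q)"
  by (induction p)
    (use assms in \<open>auto simp: poly_op_add poly_op_smult blinfun_eq_iff blinfun.add_left\<close>)

lemma is_adjoint_poly_op:
  assumes "selfadjoint A"
  shows "is_adjoint (poly_op A (map_poly cnj p)) (poly_op A p)"
proof (induction p)
  case (pCons c p)
  have adj: "cinner (A x) y = cinner x (A y)" for x y
    using assms by (simp add: selfadjoint_def is_adjoint_def)
  have A: "bounded_operator A"
    using assms by (simp add: selfadjoint_def)
  have "poly_op A (q * [:0, 1:]) = poly_op A ([:0, 1:] * q)" for q
    by (simp only: mult.commute)
  hence "A (poly_op A q x) = poly_op A q (A x)" for q x
    by (simp add: poly_op_mult A blinfun_eq_iff del: mult_pCons_left mult_pCons_right)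
  with pCons show ?case
    by (simp add: is_adjoint_def map_poly_pCons blinfun.add_left cinner_add_left cinner_add_right
        cinner_scaleC_left cinner_scaleC_right adj)
qed (simp add: is_adjoint_def cinner_zero_left cinner_zero_right)

text \<open>One half of the spectral mapping theorem: a polynomial splits into linear factors \<open>X - z\<close>,
  and \<open>A - z\<close> is invertible for every root \<open>z\<close> outside the spectrum.\<close>

lemma boundedly_invertible_poly_op:
  assumes A: "bounded_operator A" and "p \<noteq> 0" "\<And>z. poly p z = 0 \<Longrightarrow> z \<notin> spectrum A"
  shows "boundedly_invertible (poly_op A p)"
  using assms(2,3)
proof (induction "degree p" arbitrary: p)
  case 0
  then obtain c where "p = [:c:]" by (metis degree_eq_zeroE)
  thus ?case using 0 by (simp add: boundedly_invertible_scalar_op)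
next
  case (Suc d)
  have "\<not> constant (poly p)" using Suc(2) by (simp add: constant_degree)
  then obtain z where z: "poly p z = 0" using fundamental_theorem_of_algebra by blast
  then obtain r where r: "p = [:- z, 1:] * r" by (metis poly_eq_0_iff_dvd dvdE)
  have "r \<noteq> 0" using r Suc.prems by auto
  hence "degree p = Suc (degree r)" unfolding r by (subst degree_mult_eq) auto
  hence "boundedly_invertible (poly_op A r)"
    using Suc \<open>r \<noteq> 0\<close> by (auto simp: r)
  moreover have "boundedly_invertible (poly_op A [:- z, 1:])"
    using Suc.prems(2)[OF z] by (simp add: spectrum_iff scalar_op_minus)
  ultimately show ?case
    unfolding r poly_op_mult[OF A] by (intro boundedly_invertible_compose)
qed

text \<open>The other half: \<open>X - z\<close> divides \<open>p - p(z)\<close>, and factors of an invertible product of commuting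
  operators are invertible.\<close>

lemma poly_in_spectrum:
  assumes A: "bounded_operator A" and z: "z \<in> spectrum A"
  shows "poly p z \<in> spectrum (poly_op A p)"
proof (rule ccontr)
  assume "\<not> ?thesis"
  hence inv: "boundedly_invertible (poly_op A (p - [:poly p z:]))"
    by (simp add: spectrum_iff poly_op_diff A)
  have "poly (p - [:poly p z:]) z = 0" by simp
  then obtain r where r: "p - [:poly p z:] = [:- z, 1:] * r" by (metis poly_eq_0_iff_dvd dvdE)
  have "boundedly_invertible (poly_op A [:- z, 1:])"
  proof (rule boundedly_invertible_factor)
    show "boundedly_invertible (poly_op A [:- z, 1:] o\<^sub>L poly_op A r)"
      using inv unfolding r by (simp only: poly_op_mult[OF A])
    show "(poly_op A [:- z, 1:] o\<^sub>L poly_op A r) = (poly_op A r o\<^sub>L poly_op A [:- z, 1:])"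
      by (metis A mult.commute poly_op_mult)
  qed (rule bounded_operator_poly_op[OF A])
  with z show False by (simp add: spectrum_iff scalar_op_minus)
qed

lemma cmod_poly_le_norm:
  assumes "bounded_operator A" "z \<in> spectrum A"
  shows "cmod (poly p z) \<le> norm (poly_op A p)"
  using assms by (intro spectrum_norm_le poly_in_spectrum bounded_operator_poly_op)

text \<open>The norm of \<open>p(A)\<close> is attained by \<open>\<bar>p\<bar>\<close> on the spectrum. For \<open>q = cnj p * p\<close> the operator
  \<open>q(A) = p(A)\<^sup>* p(A)\<close> is selfadjoint, so \<open>\<plusminus>\<parallel>q(A)\<parallel>\<close> lies in its spectrum and hence, by spectral
  mapping, is a value \<open>q(z) = \<bar>p(z)\<bar>\<^sup>2\<close> with \<open>z\<close> in the spectrum of \<open>A\<close>.\<close>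

lemma norm_poly_op_attained:
  fixes A :: "'a::complex_hilbert_space \<Rightarrow>\<^sub>L 'a"
  assumes A: "selfadjoint A" and nontrivial: "\<exists>x::'a. x \<noteq> 0"
    and real: "spectrum A \<subseteq> range complex_of_real"
  obtains z where "z \<in> spectrum A" "norm (poly_op A p) \<le> cmod (poly p z)"
proof -
  have bA: "bounded_operator A" using A by (simp add: selfadjoint_def)
  define q where "q = map_poly cnj p * p"
  define B where "B = poly_op A q"
  have B_eq: "B = (poly_op A (map_poly cnj p) o\<^sub>L poly_op A p)"
    by (simp add: B_def q_def poly_op_mult[OF bA])
  have adj: "is_adjoint (poly_op A (map_poly cnj p)) (poly_op A p)"
    by (rule is_adjoint_poly_op[OF A])
  have "is_adjoint B B"
    using adj unfolding B_eq is_adjoint_def by (metis blinfun_apply_blinfun_compose cinner_commute)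
  hence "selfadjoint B"
    by (simp add: selfadjoint_def B_def bounded_operator_poly_op bA)
  then obtain r where r: "of_real r \<in> spectrum B" "\<bar>r\<bar> = norm B"
    using selfadjoint_norm_in_spectrum nontrivial by blast
  have "\<not> boundedly_invertible (poly_op A (q - [:of_real r:]))"
    using r(1) by (simp add: spectrum_iff B_def poly_op_diff bA)
  moreover have "spectrum A \<noteq> {}"
    using selfadjoint_norm_in_spectrum[OF A nontrivial] by blast
  ultimately obtain z where z: "z \<in> spectrum A" "poly (q - [:of_real r:]) z = 0"
    using boundedly_invertible_poly_op[OF bA, of "q - [:of_real r:]"] by fastforce
  have "cnj z = z" using real z(1) by auto
  hence "poly q z = of_real ((cmod (poly p z))\<^sup>2)"
    unfolding complex_norm_square by (simp add: q_def)
  hence "r = (cmod (poly p z))\<^sup>2"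
    using z(2) by (simp del: of_real_power)
  hence "(norm (poly_op A p))\<^sup>2 \<le> (cmod (poly p z))\<^sup>2"
    using norm_le_adjoint_compose[OF adj] r(2) by (simp add: B_eq)
  hence "norm (poly_op A p) \<le> cmod (poly p z)"
    by (rule power2_le_imp_le) simp
  thus thesis using z(1) that by blast
qed

section \<open>Existence of the continuous functional calculus\<close>

lemma uniform_polynomial_approximation:
  fixes f :: "complex \<Rightarrow> complex"
  assumes S: "compact S" "S \<subseteq> range complex_of_real" and f: "continuous_on S f"
  obtains p where "uniform_limit S (\<lambda>n. poly (p n)) f sequentially"
proof -
  have "\<exists>p. \<forall>z\<in>S. dist (poly p z) (f z) < e" if e: "e > 0" for e
  proof -
    define T where "T = Re ` S"
    have mem: "complex_of_real t \<in> S" if "t \<in> T" for t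
      using that S(2) by (force simp: T_def)
    have T: "compact T" unfolding T_def
      by (intro compact_continuous_image S continuous_intros)
    have cont: "continuous_on T (\<lambda>t. f (complex_of_real t))"
      by (rule continuous_on_compose2[OF f]) (auto intro!: continuous_intros mem)
    obtain P where P: "real_polynomial_function P"
      "\<And>t. t \<in> T \<Longrightarrow> \<bar>Re (f (of_real t)) - P t\<bar> < e / 2"
      by (rule Stone_Weierstrass_real_polynomial_function[OF T, of "\<lambda>t. Re (f (of_real t))" "e / 2"])
        (use e cont in \<open>auto intro!: continuous_intros\<close>)
    obtain Q where Q: "real_polynomial_function Q"
      "\<And>t. t \<in> T \<Longrightarrow> \<bar>Im (f (of_real t)) - Q t\<bar> < e / 2"
      by (rule Stone_Weierstrass_real_polynomial_function[OF T, of "\<lambda>t. Im (f (of_real t))" "e / 2"])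
        (use e cont in \<open>auto intro!: continuous_intros\<close>)
    have lift: "\<exists>q. \<forall>t. poly q (of_real t) = complex_of_real (R t)"
      if R: "real_polynomial_function R" for R :: "real \<Rightarrow> real"
    proof -
      obtain a n where "R = (\<lambda>t. \<Sum>i\<le>n. a i * t ^ i)"
        using R by (auto simp: real_polynomial_function_iff_sum)
      thus ?thesis
        by (intro exI[of _ "\<Sum>i\<le>n. monom (of_real (a i)) i"]) (simp add: poly_sum poly_monom)
    qed
    obtain p q where pq: "\<And>t. poly p (of_real t) = complex_of_real (P t)"
      "\<And>t. poly q (of_real t) = complex_of_real (Q t)"
      using lift P(1) Q(1) by metis
    have "dist (poly (p + smult \<i> q) z) (f z) < e" if z: "z \<in> S" for z
    proof -
      have t: "Re z \<in> T" "z = of_real (Re z)" using z S(2) by (auto simp: T_def)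
      have "dist (poly (p + smult \<i> q) z) (f z)
          = cmod (f (of_real (Re z)) - (of_real (P (Re z)) + \<i> * of_real (Q (Re z))))"
        unfolding dist_norm poly_add poly_smult pq[of "Re z", folded t(2)]
        by (subst norm_minus_commute) (simp only: t(2)[symmetric])
      also have "\<dots> \<le> \<bar>Re (f (of_real (Re z))) - P (Re z)\<bar> + \<bar>Im (f (of_real (Re z))) - Q (Re z)\<bar>"
        by (rule order_trans[OF cmod_le]) simp
      also have "\<dots> < e" using P(2)[OF t(1)] Q(2)[OF t(1)] by linarith
      finally show ?thesis .
    qed
    thus ?thesis by blast
  qed
  hence "\<forall>n. \<exists>p. \<forall>z\<in>S. dist (poly p z) (f z) < inverse (real (Suc n))" by simp
  then obtain p where p: "\<And>n z. z \<in> S \<Longrightarrow> dist (poly (p n) z) (f z) < inverse (real (Suc n))"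
    by metis
  have "uniform_limit S (\<lambda>n. poly (p n)) f sequentially"
  proof (rule uniform_limitI)
    fix e :: real assume "e > 0"
    have "\<forall>\<^sub>F n in sequentially. inverse (real (Suc n)) < e"
      using LIMSEQ_inverse_real_of_nat \<open>e > 0\<close> by (rule order_tendstoD)
    thus "\<forall>\<^sub>F n in sequentially. \<forall>z\<in>S. dist (poly (p n) z) (f z) < e"
      by (rule eventually_mono) (use p less_trans in blast)
  qed
  thus thesis by (rule that)
qed

text \<open>The graph of the functional calculus, as the closure of its polynomial part.\<close>

definition calculus_rel ::
    "('a::complex_hilbert_space \<Rightarrow>\<^sub>L 'a) \<Rightarrow> (complex \<Rightarrow> complex) \<Rightarrow> ('a \<Rightarrow>\<^sub>L 'a) \<Rightarrow> bool" where
  "calculus_rel A f B \<longleftrightarrow>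
     (\<exists>p. uniform_limit (spectrum A) (\<lambda>n. poly (p n)) f sequentially \<and>
          (\<lambda>n. poly_op A (p n)) \<longlonglongrightarrow> B)"

lemma calculus_relI:
  "uniform_limit (spectrum A) (\<lambda>n. poly (p n)) f sequentially \<Longrightarrow>
    (\<lambda>n. poly_op A (p n)) \<longlonglongrightarrow> B \<Longrightarrow> calculus_rel A f B"
  by (auto simp: calculus_rel_def)

lemma calculus_rel_poly: "calculus_rel A (poly p) (poly_op A p)"
  by (rule calculus_relI[where p = "\<lambda>_. p"]) (rule uniform_limit_const tendsto_const)+

context
  fixes A :: "'a::complex_hilbert_space \<Rightarrow>\<^sub>L 'a"
  assumes sa: "selfadjoint A" and nontrivial: "\<exists>x::'a. x \<noteq> 0"
    and real_spectrum: "spectrum A \<subseteq> range complex_of_real"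
begin

lemma bounded_op_A: "bounded_operator A"
  using sa by (simp add: selfadjoint_def)

lemma spectrum_nonempty: "spectrum A \<noteq> {}"
  using selfadjoint_norm_in_spectrum[OF sa nontrivial] by blast

text \<open>Both inequalities pass to the limit from polynomials: \<open>\<bar>p(z)\<bar> \<le> \<parallel>p(A)\<parallel>\<close> holds at each point
  of the spectrum, and equality holds at some point.\<close>

lemma calculus_rel_norm:
  assumes f: "continuous_on (spectrum A) f" and rel: "calculus_rel A f B"
  shows "norm B = (SUP z\<in>spectrum A. cmod (f z))"
proof -
  obtain p where p: "uniform_limit (spectrum A) (\<lambda>n. poly (p n)) f sequentially"
    "(\<lambda>n. poly_op A (p n)) \<longlonglongrightarrow> B"
    using rel by (auto simp: calculus_rel_def)
  have norm_lim: "(\<lambda>n. norm (poly_op A (p n))) \<longlonglongrightarrow> norm B"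
    using p(2) by (rule tendsto_norm)
  have bdd: "bdd_above ((\<lambda>z. cmod (f z)) ` spectrum A)"
    by (intro bounded_imp_bdd_above compact_imp_bounded compact_continuous_image
        compact_spectrum bounded_op_A continuous_intros f)
  have "cmod (f z) \<le> norm B" if z: "z \<in> spectrum A" for z
  proof (rule LIMSEQ_le)
    show "(\<lambda>n. cmod (poly (p n) z)) \<longlonglongrightarrow> cmod (f z)"
      by (intro tendsto_norm tendsto_uniform_limitI[OF p(1) z])
    show "\<exists>N. \<forall>n\<ge>N. cmod (poly (p n) z) \<le> norm (poly_op A (p n))"
      using cmod_poly_le_norm[OF bounded_op_A z] by blast
  qed (rule norm_lim)
  hence "(SUP z\<in>spectrum A. cmod (f z)) \<le> norm B"
    using spectrum_nonempty by (intro cSUP_least) auto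
  moreover have "norm B \<le> (SUP z\<in>spectrum A. cmod (f z)) + e" if e: "e > 0" for e
  proof (rule tendsto_upperbound[OF norm_lim])
    have "\<forall>\<^sub>F n in sequentially. \<forall>z\<in>spectrum A. dist (poly (p n) z) (f z) < e"
      using p(1) e by (rule uniform_limitD)
    thus "\<forall>\<^sub>F n in sequentially. norm (poly_op A (p n)) \<le> (SUP z\<in>spectrum A. cmod (f z)) + e"
    proof eventually_elim
      case (elim n)
      obtain z where z: "z \<in> spectrum A" "norm (poly_op A (p n)) \<le> cmod (poly (p n) z)"
        using norm_poly_op_attained[OF sa nontrivial real_spectrum] by blast
      have "cmod (poly (p n) z) \<le> cmod (f z) + e"
        using bspec[OF elim z(1)] norm_triangle_ineq2[of "poly (p n) z" "f z"]
        by (simp add: dist_norm)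
      with z(2) cSUP_upper[OF z(1) bdd] show ?case by linarith
    qed
  qed simp
  ultimately show ?thesis
    using field_le_epsilon[of "norm B" "SUP z\<in>spectrum A. cmod (f z)"] by force
qed

lemma bounded_image:
  "continuous_on (spectrum A) f \<Longrightarrow> bounded (f ` spectrum A)" for f :: "complex \<Rightarrow> complex"
  by (intro compact_imp_bounded compact_continuous_image compact_spectrum bounded_op_A)

lemma calculus_rel_add:
  assumes "calculus_rel A f B" "calculus_rel A g C"
  shows "calculus_rel A (\<lambda>z. f z + g z) (B + C)"
proof -
  obtain p q where "uniform_limit (spectrum A) (\<lambda>n. poly (p n)) f sequentially"
    "(\<lambda>n. poly_op A (p n)) \<longlonglongrightarrow> B"
    "uniform_limit (spectrum A) (\<lambda>n. poly (q n)) g sequentially"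
    "(\<lambda>n. poly_op A (q n)) \<longlonglongrightarrow> C"
    using assms by (auto simp: calculus_rel_def)
  thus ?thesis
    by (intro calculus_relI[where p = "\<lambda>n. p n + q n"])
      (auto simp: poly_op_add poly_add[abs_def] intro!: uniform_limit_add tendsto_add)
qed

lemma calculus_rel_mult:
  assumes f: "continuous_on (spectrum A) f" and g: "continuous_on (spectrum A) g"
    and rel: "calculus_rel A f B" "calculus_rel A g C"
  shows "calculus_rel A (\<lambda>z. f z * g z) (B o\<^sub>L C)"
proof -
  obtain p q where "uniform_limit (spectrum A) (\<lambda>n. poly (p n)) f sequentially"
    "(\<lambda>n. poly_op A (p n)) \<longlonglongrightarrow> B"
    "uniform_limit (spectrum A) (\<lambda>n. poly (q n)) g sequentially"
    "(\<lambda>n. poly_op A (q n)) \<longlonglongrightarrow> C"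
    using rel by (auto simp: calculus_rel_def)
  thus ?thesis
    by (intro calculus_relI[where p = "\<lambda>n. p n * q n"])
      (auto simp: poly_op_mult[OF bounded_op_A] poly_mult[abs_def] intro!: uniform_lim_mult bounded_image f g
        bounded_bilinear.tendsto[OF bounded_bilinear_blinfun_compose])
qed

lemma calculus_rel_const: "calculus_rel A (\<lambda>z. c) (scalar_op c)"
  using calculus_rel_poly[of A "[:c:]"] by (simp add: poly_pCons[abs_def])

lemma calculus_rel_scale:
  assumes "continuous_on (spectrum A) f" "calculus_rel A f B"
  shows "calculus_rel A (\<lambda>z. c * f z) (scalar_op c o\<^sub>L B)"
  using calculus_rel_mult[OF _ assms(1) calculus_rel_const assms(2)] by simp

lemma calculus_rel_unique:
  assumes f: "continuous_on (spectrum A) f" and rel: "calculus_rel A f B" "calculus_rel A f C"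
  shows "B = C"
proof -
  have "calculus_rel A (\<lambda>z. f z + (- 1) * f z) (B + (scalar_op (- 1) o\<^sub>L C))"
    by (intro calculus_rel_add calculus_rel_scale rel f)
  hence "norm (B + (scalar_op (- 1) o\<^sub>L C)) = (SUP z\<in>spectrum A. cmod (f z + (- 1) * f z))"
    by (intro calculus_rel_norm) (auto intro!: continuous_intros f)
  hence "B + (scalar_op (- 1) o\<^sub>L C) = 0"
    using spectrum_nonempty by simp
  thus ?thesis
    by (simp add: blinfun_eq_iff blinfun.add_left scaleC_minus_one)
qed

text \<open>By the isometry on polynomials, uniformly convergent polynomials give a Cauchy sequence of
  operators.\<close>

lemma convergent_poly_op:
  assumes "uniform_limit (spectrum A) (\<lambda>n. poly (p n)) f sequentially"
  shows "convergent (\<lambda>n. poly_op A (p n))"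
proof (rule Cauchy_convergent, rule metric_CauchyI)
  fix e :: real assume "e > 0"
  hence "\<forall>\<^sub>F n in sequentially. \<forall>z\<in>spectrum A. dist (poly (p n) z) (f z) < e / 2"
    using assms by (intro uniform_limitD) auto
  then obtain N where N: "\<And>n z. n \<ge> N \<Longrightarrow> z \<in> spectrum A \<Longrightarrow> dist (poly (p n) z) (f z) < e / 2"
    by (auto simp: eventually_sequentially)
  have "dist (poly_op A (p m)) (poly_op A (p n)) < e" if mn: "m \<ge> N" "n \<ge> N" for m n
  proof -
    obtain z where z: "z \<in> spectrum A"
      "norm (poly_op A (p m - p n)) \<le> cmod (poly (p m - p n) z)"
      using norm_poly_op_attained[OF sa nontrivial real_spectrum] by blast
    have "dist (poly (p m) z) (poly (p n) z) < e"
      by (rule dist_triangle_half_l[OF N[OF mn(1) z(1)] N[OF mn(2) z(1)]])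
    with z(2) show ?thesis
      by (simp add: poly_op_diff[OF bounded_op_A] dist_norm)
  qed
  thus "\<exists>N. \<forall>m\<ge>N. \<forall>n\<ge>N. dist (poly_op A (p m)) (poly_op A (p n)) < e" by blast
qed

lemma calculus_rel_exists:
  assumes "continuous_on (spectrum A) f"
  shows "\<exists>B. calculus_rel A f B"
proof -
  obtain p where "uniform_limit (spectrum A) (\<lambda>n. poly (p n)) f sequentially"
    using uniform_polynomial_approximation[OF compact_spectrum[OF bounded_op_A] real_spectrum assms] .
  with convergent_poly_op[OF this] show ?thesis
    by (auto simp: convergent_def calculus_rel_def)
qed

lemma calculus_rel_bounded_operator: "calculus_rel A f B \<Longrightarrow> bounded_operator B"
  by (auto simp: calculus_rel_def
      intro: bounded_operator_limit[OF bounded_operator_poly_op[OF bounded_op_A]])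

text \<open>If \<open>p\<^sub>n\<close> approximates \<open>f\<close>, then the polynomials with conjugated coefficients approximate
  \<open>cnj f\<close>, because conjugation fixes the points of a real spectrum.\<close>

lemma calculus_rel_cnj:
  assumes f: "continuous_on (spectrum A) f"
    and rel: "calculus_rel A f B" "calculus_rel A (\<lambda>z. cnj (f z)) C"
  shows "is_adjoint C B"
proof -
  obtain p where p: "uniform_limit (spectrum A) (\<lambda>n. poly (p n)) f sequentially"
    "(\<lambda>n. poly_op A (p n)) \<longlonglongrightarrow> B"
    using rel(1) by (auto simp: calculus_rel_def)
  have "cnj z = z" if "z \<in> spectrum A" for z
    using that real_spectrum by auto
  moreover have "dist (cnj a) (cnj b) = dist a b" for a b
    by (metis complex_cnj_diff complex_mod_cnj dist_norm)
  ultimately have lim: "uniform_limit (spectrum A) (\<lambda>n. poly (map_poly cnj (p n)))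
      (\<lambda>z. cnj (f z)) sequentially"
    using p(1) by (simp add: uniform_limit_iff)
  obtain C' where C': "(\<lambda>n. poly_op A (map_poly cnj (p n))) \<longlonglongrightarrow> C'"
    using convergent_poly_op[OF lim] unfolding convergent_def by blast
  with lim have "calculus_rel A (\<lambda>z. cnj (f z)) C'"
    by (rule calculus_relI)
  hence "C' = C"
    using rel(2) by (intro calculus_rel_unique) (auto intro!: continuous_intros f)
  thus ?thesis
    using is_adjoint_limit[OF is_adjoint_poly_op[OF sa] p(2) C'] by simp
qed

lemma functional_calculus_exists: "\<exists>\<Phi>. is_functional_calculus A \<Phi>"
proof
  define \<Phi> where "\<Phi> f = (SOME B. calculus_rel A f B)" for f
  have rel: "calculus_rel A f (\<Phi> f)" if "continuous_on (spectrum A) f" for f :: "complex \<Rightarrow> complex"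
    unfolding \<Phi>_def using calculus_rel_exists[OF that] by (rule someI_ex)
  have eq: "\<Phi> f = B" if "continuous_on (spectrum A) f" "calculus_rel A f B" for B and f :: "complex \<Rightarrow> complex"
    using calculus_rel_unique rel that by blast
  show "is_functional_calculus A \<Phi>"
    unfolding is_functional_calculus_def
  proof (intro conjI allI impI)
    fix f :: "complex \<Rightarrow> complex" assume f: "continuous_on (spectrum A) f"
    show "bounded_operator (\<Phi> f)"
      using rel[OF f] by (rule calculus_rel_bounded_operator)
    show "norm (\<Phi> f) = (SUP z\<in>spectrum A. cmod (f z))"
      by (rule calculus_rel_norm[OF f rel[OF f]])
    have "\<Phi> (\<lambda>z. c * f z) = (scalar_op c o\<^sub>L \<Phi> f)" for c
      by (intro eq calculus_rel_scale rel f) (auto intro!: continuous_intros f)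
    thus "\<Phi> (\<lambda>z. c * f z) x = c *\<^sub>C \<Phi> f x" for c x
      by simp
    show "is_adjoint (\<Phi> (\<lambda>z. cnj (f z))) (\<Phi> f)"
      by (intro calculus_rel_cnj[OF f rel[OF f]] rel) (auto intro!: continuous_intros f)
  next
    fix f g :: "complex \<Rightarrow> complex"
    assume fg: "continuous_on (spectrum A) f" "continuous_on (spectrum A) g"
    show "\<Phi> (\<lambda>z. f z + g z) = \<Phi> f + \<Phi> g"
      by (intro eq calculus_rel_add rel fg) (auto intro!: continuous_intros fg)
    show "\<Phi> (\<lambda>z. f z * g z) = (\<Phi> f o\<^sub>L \<Phi> g)"
      by (intro eq calculus_rel_mult rel fg) (auto intro!: continuous_intros fg)
  next
    show "\<Phi> (\<lambda>z. 1) = id_blinfun"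
      using calculus_rel_const[of 1] by (intro eq) auto
    show "\<Phi> (\<lambda>z. z) = A"
      using calculus_rel_poly[of A "[:0, 1:]"] by (intro eq) (auto simp: poly_pCons[abs_def])
  qed
qed

lemma is_functional_calculus_functional_calculus:
  "is_functional_calculus A (functional_calculus A)"
  unfolding functional_calculus_def using functional_calculus_exists by (rule someI_ex)

text \<open>The isometry condition, applied to \<open>f - g\<close>.\<close>

lemma functional_calculus_cong:
  assumes f: "continuous_on (spectrum A) f" and g: "continuous_on (spectrum A) g"
    and fg: "\<And>z. z \<in> spectrum A \<Longrightarrow> f z = g z"
  shows "functional_calculus A f = functional_calculus A g"
proof -
  let ?\<Phi> = "functional_calculus A"
  note fc = is_functional_calculus_functional_calculus[unfolded is_functional_calculus_def]
  have g': "continuous_on (spectrum A) (\<lambda>z. (- 1) * g z)"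
    by (intro continuous_intros g)
  have "norm (?\<Phi> (\<lambda>z. f z + (- 1) * g z)) = (SUP z\<in>spectrum A. cmod (f z + (- 1) * g z))"
    using fc continuous_on_add[OF f g'] by blast
  also have "\<dots> = (SUP z\<in>spectrum A. 0)"
    by (rule SUP_cong) (simp_all add: fg)
  also have "\<dots> = 0"
    using spectrum_nonempty by simp
  finally have "?\<Phi> (\<lambda>z. f z + (- 1) * g z) = 0"
    by simp
  hence "?\<Phi> f + ?\<Phi> (\<lambda>z. (- 1) * g z) = 0"
    using fc f g' by metis
  moreover have "?\<Phi> (\<lambda>z. (- 1) * g z) x = (- 1) *\<^sub>C ?\<Phi> g x" for x
    using fc g by blast
  ultimately show ?thesis
    by (metis (no_types, lifting) add.right_inverse add_right_cancel blinfun.add_left blinfun_eqI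
        scaleC_minus_one zero_blinfun.rep_eq)
qed

end

section \<open>The quadratic form of a function of an operator\<close>

context
  fixes A :: "'a::complex_hilbert_space \<Rightarrow>\<^sub>L 'a" and a b :: real
  assumes sa: "selfadjoint A" and nontrivial: "\<exists>x::'a. x \<noteq> 0"
    and spectrum: "spectrum A \<subseteq> complex_of_real ` {a..b}"
begin

lemma real_spectrum': "spectrum A \<subseteq> range complex_of_real"
  using spectrum by auto

lemmas calculus_cong = functional_calculus_cong[OF sa nontrivial real_spectrum']
  and calculus = is_functional_calculus_functional_calculus[OF sa nontrivial real_spectrum',
    unfolded is_functional_calculus_def]

lemma continuous_on_lift:
  assumes "continuous_on {a..b} F"
  shows "continuous_on (spectrum A) (\<lambda>z. complex_of_real (F (Re z)))"
  by (intro continuous_intros continuous_on_compose2[OF assms]) (use spectrum in auto)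

lemma apply_fun_cong:
  assumes "continuous_on {a..b} F" "\<And>t. t \<in> {a..b} \<Longrightarrow> F t = G t"
  shows "apply_fun F A = apply_fun G A"
proof -
  have "continuous_on {a..b} G"
    using assms continuous_on_cong by metis
  thus ?thesis
    unfolding apply_fun_def
    by (intro calculus_cong continuous_on_lift assms(1)) (use assms(2) spectrum in auto)
qed

lemma apply_fun_mult:
  assumes "continuous_on {a..b} F" "continuous_on {a..b} G"
  shows "apply_fun (\<lambda>t. F t * G t) A = (apply_fun F A o\<^sub>L apply_fun G A)"
  using calculus assms[THEN continuous_on_lift] unfolding apply_fun_def by simp

lemma apply_fun_add:
  assumes "continuous_on {a..b} F" "continuous_on {a..b} G"
  shows "apply_fun (\<lambda>t. F t + G t) A = apply_fun F A + apply_fun G A"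
  using calculus assms[THEN continuous_on_lift] unfolding apply_fun_def by simp

lemma apply_fun_scale:
  assumes "continuous_on {a..b} F"
  shows "apply_fun (\<lambda>t. c * F t) A x = complex_of_real c *\<^sub>C apply_fun F A x"
  using calculus continuous_on_lift[OF assms] unfolding apply_fun_def of_real_mult by blast

lemma apply_fun_one: "apply_fun (\<lambda>t. 1) A = id_blinfun"
  using calculus unfolding apply_fun_def by simp

lemma apply_fun_id: "apply_fun (\<lambda>t. t) A = A"
proof -
  have "apply_fun (\<lambda>t. t) A = functional_calculus A (\<lambda>z. z)"
    unfolding apply_fun_def
    by (intro calculus_cong continuous_on_lift continuous_intros) (use spectrum in auto)
  thus ?thesis using calculus by simp
qed

lemma quadratic_form_linear:
  assumes F: "continuous_on {a..b} F" and G: "continuous_on {a..b} G"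
  shows "Re (cinner (apply_fun (\<lambda>t. c * F t + d * G t) A x) x)
    = c * Re (cinner (apply_fun F A x) x) + d * Re (cinner (apply_fun G A x) x)"
proof -
  have "apply_fun (\<lambda>t. c * F t + d * G t) A
      = apply_fun (\<lambda>t. c * F t) A + apply_fun (\<lambda>t. d * G t) A"
    by (intro apply_fun_add continuous_intros F G)
  thus ?thesis
    by (simp add: blinfun.add_left apply_fun_scale F G cinner_add_left cinner_scaleC_left)
qed

text \<open>A nonnegative \<open>F\<close> has a continuous square root \<open>R\<close>, and \<open>R(A)\<close> is selfadjoint, so
  \<open>\<langle>F(A) x, x\<rangle> = \<parallel>R(A) x\<parallel>\<^sup>2\<close>.\<close>

lemma quadratic_form_nonneg:
  assumes F: "continuous_on {a..b} F" and nonneg: "\<And>t. t \<in> {a..b} \<Longrightarrow> 0 \<le> F t"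
  shows "0 \<le> Re (cinner (apply_fun F A x) x)"
proof -
  define R where "R t = sqrt (F t)" for t
  have R: "continuous_on {a..b} R"
    unfolding R_def by (intro continuous_intros F)
  have "is_adjoint (functional_calculus A (\<lambda>z. cnj (complex_of_real (R (Re z))))) (apply_fun R A)"
    using calculus continuous_on_lift[OF R] unfolding apply_fun_def by blast
  hence adj: "is_adjoint (apply_fun R A) (apply_fun R A)"
    by (simp add: apply_fun_def)
  have "apply_fun F A = (apply_fun R A o\<^sub>L apply_fun R A)"
    unfolding apply_fun_mult[OF R R, symmetric]
    by (rule apply_fun_cong[OF F]) (simp add: R_def nonneg)
  hence "Re (cinner (apply_fun F A x) x) = (norm (apply_fun R A x))\<^sup>2"
    using adj by (metis Re_cinner_self blinfun_apply_blinfun_compose is_adjoint_def)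
  thus ?thesis by simp
qed

end

section \<open>Sums of quadratic forms\<close>

context
  fixes A :: "nat \<Rightarrow> 'a::complex_hilbert_space \<Rightarrow>\<^sub>L 'a" and n :: nat and a b :: real
    and x :: "nat \<Rightarrow> 'a"
  assumes sa: "\<forall>j\<in>{1..n}. selfadjoint (A j)"
    and spectra: "\<forall>j\<in>{1..n}. spectrum (A j) \<subseteq> complex_of_real ` {a..b}"
    and unit: "(\<Sum>j = 1..n. (norm (x j))\<^sup>2) = 1"
begin

lemma nontrivial_space: "\<exists>y::'a. y \<noteq> 0"
proof (rule ccontr)
  assume "\<not> ?thesis"
  hence "x j = 0" for j by blast
  thus False using unit by simp
qed

lemmas operator_facts = bspec[OF sa] nontrivial_space bspec[OF spectra]

lemma quad_sum_linear:
  assumes "continuous_on {a..b} F" "continuous_on {a..b} G"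
  shows "quad_sum n (\<lambda>j. apply_fun (\<lambda>t. c * F t + d * G t) (A j)) x
    = c * quad_sum n (\<lambda>j. apply_fun F (A j)) x + d * quad_sum n (\<lambda>j. apply_fun G (A j)) x"
  using assms
  by (simp add: quad_sum_def quadratic_form_linear[OF operator_facts] sum.distrib sum_distrib_left)

lemma quad_sum_nonneg:
  assumes "continuous_on {a..b} F" "\<And>t. t \<in> {a..b} \<Longrightarrow> 0 \<le> F t"
  shows "0 \<le> quad_sum n (\<lambda>j. apply_fun F (A j)) x"
  unfolding quad_sum_def
  using assms by (intro sum_nonneg quadratic_form_nonneg[OF operator_facts])

lemma quad_sum_compose:
  assumes "continuous_on {a..b} F" "continuous_on {a..b} G"
  shows "quad_sum n (\<lambda>j. apply_fun F (A j) o\<^sub>L apply_fun G (A j)) x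
    = quad_sum n (\<lambda>j. apply_fun (\<lambda>t. F t * G t) (A j)) x"
  unfolding quad_sum_def
  using assms by (intro sum.cong refl) (simp add: apply_fun_mult[OF operator_facts])

lemma quad_sum_one: "quad_sum n (\<lambda>j. apply_fun (\<lambda>t. 1) (A j)) x = 1"
  using unit by (simp add: quad_sum_def apply_fun_one[OF operator_facts] Re_cinner_self)

lemma quad_sum_id: "quad_sum n (\<lambda>j. apply_fun (\<lambda>t. t) (A j)) x = quad_sum n A x"
  by (simp add: quad_sum_def apply_fun_id[OF operator_facts])

lemma quad_sum_in_interval: "quad_sum n A x \<in> {a..b}"
proof -
  have "0 \<le> quad_sum n (\<lambda>j. apply_fun (\<lambda>t. 1 * t + (- a) * 1) (A j)) x"
    "0 \<le> quad_sum n (\<lambda>j. apply_fun (\<lambda>t. (- 1) * t + b * 1) (A j)) x"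
    by (intro quad_sum_nonneg; auto intro!: continuous_intros)+
  thus ?thesis
    by (simp only: quad_sum_linear[OF continuous_on_id continuous_on_const]
        quad_sum_one quad_sum_id) simp
qed

end

section \<open>The Chebyshev-type inequality\<close>

lemma linear_functional_gap:
  fixes L :: "(real \<Rightarrow> real) \<Rightarrow> real"
  assumes linear: "\<And>c d F G. continuous_on S F \<Longrightarrow> continuous_on S G \<Longrightarrow>
      L (\<lambda>t. c * F t + d * G t) = c * L F + d * L G"
    and cont: "continuous_on S h" "continuous_on S f" "continuous_on S g"
  shows "L (\<lambda>t. (h s * f t - h t * f s) * (h s * g t - h t * g s))
    = (h s)\<^sup>2 * L (\<lambda>t. f t * g t) - h s * g s * L (\<lambda>t. h t * f t)
      - h s * f s * L (\<lambda>t. h t * g t) + f s * g s * L (\<lambda>t. (h t)\<^sup>2)"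
proof -
  have "(\<lambda>t. (h s * f t - h t * f s) * (h s * g t - h t * g s))
      = (\<lambda>t. 1 * ((h s)\<^sup>2 * (f t * g t) + (- h s * g s) * (h t * f t))
        + 1 * ((- h s * f s) * (h t * g t) + (f s * g s) * (h t)\<^sup>2))"
    by (simp add: fun_eq_iff algebra_simps power2_eq_square)
  hence "L (\<lambda>t. (h s * f t - h t * f s) * (h s * g t - h t * g s))
      = 1 * L (\<lambda>t. (h s)\<^sup>2 * (f t * g t) + (- h s * g s) * (h t * f t))
        + 1 * L (\<lambda>t. (- h s * f s) * (h t * g t) + (f s * g s) * (h t)\<^sup>2)"
    by (simp only:) (intro linear continuous_intros cont)
  also have "L (\<lambda>t. (h s)\<^sup>2 * (f t * g t) + (- h s * g s) * (h t * f t))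
      = (h s)\<^sup>2 * L (\<lambda>t. f t * g t) + (- h s * g s) * L (\<lambda>t. h t * f t)"
    by (intro linear continuous_intros cont)
  also have "L (\<lambda>t. (- h s * f s) * (h t * g t) + (f s * g s) * (h t)\<^sup>2)
      = (- h s * f s) * L (\<lambda>t. h t * g t) + (f s * g s) * L (\<lambda>t. (h t)\<^sup>2)"
    by (intro linear continuous_intros cont)
  finally show ?thesis by simp
qed

theorem theorem2p27:
  fixes A :: "nat \<Rightarrow> 'a::complex_hilbert_space \<Rightarrow>\<^sub>L 'a"
    and n :: nat
    and \<gamma> \<Gamma> :: real
    and h f g :: "real \<Rightarrow> real"
  assumes "n \<ge> 1"
    and "\<gamma> < \<Gamma>"
    and "\<And>j. j \<in> {1..n} \<Longrightarrow> selfadjoint (A j)"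
    and "\<And>j. j \<in> {1..n} \<Longrightarrow> spectrum (A j) \<subseteq> complex_of_real ` {\<gamma>..\<Gamma>}"
    and "\<And>t. t \<in> {\<gamma>..\<Gamma>} \<Longrightarrow> 0 \<le> h t"
    and "continuous_on {\<gamma>..\<Gamma>} h"
    and "continuous_on {\<gamma>..\<Gamma>} f"
    and "continuous_on {\<gamma>..\<Gamma>} g"
  shows "(h_synchronous_on {\<gamma>..\<Gamma>} h f g \<longrightarrow>
      (\<forall>x :: nat \<Rightarrow> 'a. (\<Sum>j = 1..n. (norm (x j))\<^sup>2) = 1 \<longrightarrow>
        (h (quad_sum n A x))\<^sup>2
            * quad_sum n (\<lambda>j. apply_fun f (A j) o\<^sub>L apply_fun g (A j)) x
          - quad_sum n (\<lambda>j. apply_fun h (A j) o\<^sub>L apply_fun f (A j)) x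
            * quad_sum n (\<lambda>j. apply_fun h (A j) o\<^sub>L apply_fun g (A j)) x
        \<ge> (h (quad_sum n A x) * quad_sum n (\<lambda>j. apply_fun h (A j) o\<^sub>L apply_fun f (A j)) x
            - quad_sum n (\<lambda>j. apply_fun (\<lambda>t. (h t)\<^sup>2) (A j)) x * f (quad_sum n A x))
            * g (quad_sum n A x)
          + (h (quad_sum n A x) * f (quad_sum n A x)
            - quad_sum n (\<lambda>j. apply_fun h (A j) o\<^sub>L apply_fun f (A j)) x)
            * quad_sum n (\<lambda>j. apply_fun h (A j) o\<^sub>L apply_fun g (A j)) x))
    \<and> (h_asynchronous_on {\<gamma>..\<Gamma>} h f g \<longrightarrow>
      (\<forall>x :: nat \<Rightarrow> 'a. (\<Sum>j = 1..n. (norm (x j))\<^sup>2) = 1 \<longrightarrow>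
        (h (quad_sum n A x))\<^sup>2
            * quad_sum n (\<lambda>j. apply_fun f (A j) o\<^sub>L apply_fun g (A j)) x
          - quad_sum n (\<lambda>j. apply_fun h (A j) o\<^sub>L apply_fun f (A j)) x
            * quad_sum n (\<lambda>j. apply_fun h (A j) o\<^sub>L apply_fun g (A j)) x
        \<le> (h (quad_sum n A x) * quad_sum n (\<lambda>j. apply_fun h (A j) o\<^sub>L apply_fun f (A j)) x
            - quad_sum n (\<lambda>j. apply_fun (\<lambda>t. (h t)\<^sup>2) (A j)) x * f (quad_sum n A x))
            * g (quad_sum n A x)
          + (h (quad_sum n A x) * f (quad_sum n A x)
            - quad_sum n (\<lambda>j. apply_fun h (A j) o\<^sub>L apply_fun f (A j)) x)
            * quad_sum n (\<lambda>j. apply_fun h (A j) o\<^sub>L apply_fun g (A j)) x))"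
proof -
  define q where "q x = quad_sum n A x" for x
  define L where "L F x = quad_sum n (\<lambda>j. apply_fun F (A j)) x" for F x
  define D where "D s t = (h s * f t - h t * f s) * (h s * g t - h t * g s)" for s t
  note cont = assms(6-8)
  have operators: "\<forall>j\<in>{1..n}. selfadjoint (A j)"
    "\<forall>j\<in>{1..n}. spectrum (A j) \<subseteq> complex_of_real ` {\<gamma>..\<Gamma>}"
    using assms(3,4) by blast+
  have contD: "continuous_on {\<gamma>..\<Gamma>} (D s)" for s
    unfolding D_def by (intro continuous_intros cont)
  have gap: "L (D (q x)) x
      = (h (q x))\<^sup>2 * quad_sum n (\<lambda>j. apply_fun f (A j) o\<^sub>L apply_fun g (A j)) x
        - h (q x) * g (q x) * quad_sum n (\<lambda>j. apply_fun h (A j) o\<^sub>L apply_fun f (A j)) x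
        - h (q x) * f (q x) * quad_sum n (\<lambda>j. apply_fun h (A j) o\<^sub>L apply_fun g (A j)) x
        + f (q x) * g (q x) * quad_sum n (\<lambda>j. apply_fun (\<lambda>t. (h t)\<^sup>2) (A j)) x"
    if unit: "(\<Sum>j = 1..n. (norm (x j))\<^sup>2) = 1" for x
  proof -
    note data = operators unit
    show ?thesis
      unfolding quad_sum_compose[OF data cont(2,3)] quad_sum_compose[OF data cont(1,2)]
        quad_sum_compose[OF data cont(1,3)] D_def L_def
      by (rule linear_functional_gap[OF quad_sum_linear[OF data] cont])
  qed
  show ?thesis
    unfolding q_def[symmetric]
  proof (intro conjI impI allI)
    fix x :: "nat \<Rightarrow> 'a"
    assume sync: "h_synchronous_on {\<gamma>..\<Gamma>} h f g" and unit: "(\<Sum>j = 1..n. (norm (x j))\<^sup>2) = 1"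
    note data = operators unit
    have "0 \<le> L (D (q x)) x"
      unfolding L_def
    proof (rule quad_sum_nonneg[OF data contD])
      show "0 \<le> D (q x) t" if "t \<in> {\<gamma>..\<Gamma>}" for t
        using sync that quad_sum_in_interval[OF data]
        unfolding h_synchronous_on_def D_def q_def by blast
    qed
    with gap[OF unit] show "(h (q x))\<^sup>2
            * quad_sum n (\<lambda>j. apply_fun f (A j) o\<^sub>L apply_fun g (A j)) x
          - quad_sum n (\<lambda>j. apply_fun h (A j) o\<^sub>L apply_fun f (A j)) x
            * quad_sum n (\<lambda>j. apply_fun h (A j) o\<^sub>L apply_fun g (A j)) x
        \<ge> (h (q x) * quad_sum n (\<lambda>j. apply_fun h (A j) o\<^sub>L apply_fun f (A j)) x
            - quad_sum n (\<lambda>j. apply_fun (\<lambda>t. (h t)\<^sup>2) (A j)) x * f (q x))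
            * g (q x)
          + (h (q x) * f (q x)
            - quad_sum n (\<lambda>j. apply_fun h (A j) o\<^sub>L apply_fun f (A j)) x)
            * quad_sum n (\<lambda>j. apply_fun h (A j) o\<^sub>L apply_fun g (A j)) x"
      by (simp add: algebra_simps)
  next
    fix x :: "nat \<Rightarrow> 'a"
    assume async: "h_asynchronous_on {\<gamma>..\<Gamma>} h f g" and unit: "(\<Sum>j = 1..n. (norm (x j))\<^sup>2) = 1"
    note data = operators unit
    \<comment> \<open>\<open>- D\<close>, in the shape of a linear combination\<close>
    have "0 \<le> L (\<lambda>t. (- 1) * D (q x) t + 0 * D (q x) t) x"
      unfolding L_def
    proof (rule quad_sum_nonneg[OF data])
      show "0 \<le> (- 1) * D (q x) t + 0 * D (q x) t" if "t \<in> {\<gamma>..\<Gamma>}" for t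
        using async that quad_sum_in_interval[OF data]
        unfolding h_asynchronous_on_def D_def q_def by simp
    qed (intro continuous_intros contD)
    hence "L (D (q x)) x \<le> 0"
      unfolding L_def quad_sum_linear[OF data contD contD] by simp
    with gap[OF unit] show "(h (q x))\<^sup>2
            * quad_sum n (\<lambda>j. apply_fun f (A j) o\<^sub>L apply_fun g (A j)) x
          - quad_sum n (\<lambda>j. apply_fun h (A j) o\<^sub>L apply_fun f (A j)) x
            * quad_sum n (\<lambda>j. apply_fun h (A j) o\<^sub>L apply_fun g (A j)) x
        \<le> (h (q x) * quad_sum n (\<lambda>j. apply_fun h (A j) o\<^sub>L apply_fun f (A j)) x
            - quad_sum n (\<lambda>j. apply_fun (\<lambda>t. (h t)\<^sup>2) (A j)) x * f (q x))
            * g (q x)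
          + (h (q x) * f (q x)
            - quad_sum n (\<lambda>j. apply_fun h (A j) o\<^sub>L apply_fun f (A j)) x)
            * quad_sum n (\<lambda>j. apply_fun h (A j) o\<^sub>L apply_fun g (A j)) x"
      by (simp add: algebra_simps)
  qed
qed

end
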